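(* For every integer $n\ge 4$, $$ \sum_{l=0}^3(-1)^l\binom{3}{l}\sum_{\substack{j_1+j_2+j_3=n-2 l\\ j_1, j_2, j_3\ge 1}}B_{j_1}B_{j_2}B_{j_3} =\binom{n-1}{2}B_{n-2}-\binom{n-4}{2}B_{n-4}\,. $$
   Context: The balancing numbers $B_n$ are defined by $B_0=0$, $B_1=1$ and $B_n=6B_{n-1}-B_{n-2}$ for $n\ge 2$. The inner sum runs over all ordered triples of positive integers with the indicated sum (it is empty, hence $0$, if no such triple exists). *)

theory Defs
  imports Main
begin

fun balancing :: "nat \<Rightarrow> int" where
  "balancing 0 = 0"
| "balancing (Suc 0) = 1"
| "balancing (Suc (Suc n)) = 6 * balancing (Suc n) - balancing n"

(* The sum condition lives in int, since m may be negative; the set is then empty. *)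
definition pos_triples :: "int \<Rightarrow> (nat \<times> nat \<times> nat) set" where
  "pos_triples m =
    {(j1, j2, j3). j1 \<ge> 1 \<and> j2 \<ge> 1 \<and> j3 \<ge> 1 \<and> int j1 + int j2 + int j3 = m}"

end

theory Submission
  imports Defs "HOL-Computational_Algebra.Formal_Power_Series"
begin

text \<open>
  Let \<open>F = x / (1 - 6x + x\<^sup>2)\<close> be the generating function of the balancing numbers. The left-hand
  side is the coefficient of \<open>x\<^sup>n\<close> in \<open>(1 - x\<^sup>2)\<^sup>3 F\<^sup>3\<close>. Since \<open>x\<^sup>2 F' = (1 - x\<^sup>2) F\<^sup>2\<close>,
  differentiating once more expresses the cube through derivatives of \<open>F\<close>:
  \<open>2 (1 - x\<^sup>2)\<^sup>3 F\<^sup>3 = 2 x\<^sup>3 F' + (x\<^sup>4 - x\<^sup>6) F''\<close>, and the coefficients of the right-hand side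
  are immediate.
\<close>

definition balancing_fps :: "int fps" where
  "balancing_fps = Abs_fps balancing"

lemma balancing_fps_nth [simp]: "fps_nth balancing_fps n = balancing n"
  by (simp add: balancing_fps_def)

lemma balancing_fps_eq:
  "balancing_fps * (1 - 6 * fps_X + fps_X ^ 2) = fps_X"
proof (rule fps_ext)
  fix n
  have eq: "balancing_fps * (1 - 6 * fps_X + fps_X ^ 2) =
      balancing_fps - fps_const 6 * (fps_X * balancing_fps) + fps_X ^ 2 * balancing_fps"
    by (simp add: algebra_simps numeral_fps_const)
  show "fps_nth (balancing_fps * (1 - 6 * fps_X + fps_X ^ 2)) n = fps_nth fps_X n"
    unfolding eq
    \<comment> \<open>The two initial values give the coefficients 0 and 1; from degree 2 on the
      recurrence makes them vanish.\<close>
    by (cases n rule: balancing.cases) (auto simp: fps_X_power_mult_nth)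
qed

lemma balancing_fps_deriv:
  "fps_X ^ 2 * fps_deriv balancing_fps = (1 - fps_X ^ 2) * balancing_fps ^ 2"
proof -
  define D :: "int fps" where "D = 1 - 6 * fps_X + fps_X ^ 2"
  have FD: "balancing_fps * D = fps_X"
    using balancing_fps_eq by (simp add: D_def)
  have D': "fps_deriv D = 2 * fps_X - 6"
    by (simp add: D_def fps_deriv_power numeral_fps_const flip: fps_const_add)
  have FD': "balancing_fps * (2 * fps_X - 6) + fps_deriv balancing_fps * D = 1"
    using arg_cong[OF FD, of fps_deriv] by (simp add: D' add.commute)
  have "fps_nth D 0 = 1"
    by (simp add: D_def numeral_fps_const)
  hence "D ^ 2 \<noteq> 0" by auto
  moreover have "D ^ 2 * (fps_X ^ 2 * fps_deriv balancing_fps) =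
      D ^ 2 * ((1 - fps_X ^ 2) * balancing_fps ^ 2)"
  proof -
    have "D ^ 2 * (fps_X ^ 2 * fps_deriv balancing_fps) =
        D * fps_X ^ 2 * (fps_deriv balancing_fps * D)"
      by (simp add: power2_eq_square mult_ac)
    also have "fps_deriv balancing_fps * D = 1 - balancing_fps * (2 * fps_X - 6)"
      using FD' by (simp add: algebra_simps)
    also have "D * fps_X ^ 2 * \<dots> = fps_X ^ 2 * (D - (balancing_fps * D) * (2 * fps_X - 6))"
      by (simp add: algebra_simps)
    also have "\<dots> = (1 - fps_X ^ 2) * (balancing_fps * D) ^ 2"
      unfolding FD by (simp add: D_def algebra_simps power2_eq_square)
    finally show ?thesis
      by (simp add: power_mult_distrib mult_ac)
  qed
  ultimately show ?thesis
    by (metis mult_left_cancel)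
qed

lemma balancing_fps_cube:
  "2 * ((1 - fps_X ^ 2) ^ 3 * balancing_fps ^ 3) =
     2 * (fps_X ^ 3 * fps_deriv balancing_fps) +
     (fps_X ^ 4 - fps_X ^ 6) * fps_deriv (fps_deriv balancing_fps)"
proof -
  let ?F = balancing_fps and ?F' = "fps_deriv balancing_fps"
  let ?F'' = "fps_deriv ?F'"
  have deriv: "2 * (1 - fps_X ^ 2) * ?F * ?F' =
      2 * fps_X * ?F' + fps_X ^ 2 * ?F'' + 2 * fps_X * ?F ^ 2"
    using arg_cong[OF balancing_fps_deriv, of fps_deriv]
    by (simp add: fps_deriv_power numeral_fps_const algebra_simps power2_eq_square)
  have "2 * ((1 - fps_X ^ 2) ^ 3 * ?F ^ 3) =
      2 * (1 - fps_X ^ 2) ^ 2 * ?F * ((1 - fps_X ^ 2) * ?F ^ 2)"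
    by (simp add: power2_eq_square power3_eq_cube mult_ac)
  also have "\<dots> = fps_X ^ 2 * (1 - fps_X ^ 2) * (2 * (1 - fps_X ^ 2) * ?F * ?F')"
    unfolding balancing_fps_deriv[symmetric] by (simp add: power2_eq_square mult_ac)
  \<comment> \<open>The leftover F^2 from differentiating is grouped with a factor 1 - x^2, so that
    the first-order identity applies again; the resulting x^5 F' terms then cancel.\<close>
  also have "\<dots> = fps_X ^ 2 * (1 - fps_X ^ 2) * (2 * fps_X * ?F' + fps_X ^ 2 * ?F'')
      + 2 * fps_X ^ 3 * ((1 - fps_X ^ 2) * ?F ^ 2)"
    unfolding deriv by (simp add: algebra_simps power2_eq_square power3_eq_cube)
  also have "\<dots> = 2 * (fps_X ^ 3 * ?F') + (fps_X ^ 4 - fps_X ^ 6) * ?F''"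
    unfolding balancing_fps_deriv[symmetric] by (simp add: algebra_simps eval_nat_numeral)
  finally show ?thesis .
qed

lemma sum_pos_triples_balancing:
  "(\<Sum>(j1, j2, j3)\<in>pos_triples (int m). balancing j1 * balancing j2 * balancing j3) =
     fps_nth (balancing_fps ^ 3) m"
proof -
  let ?S = "SIGMA i:{0..m}. {0..m - i}"
  have fin: "finite (pos_triples (int m))"
    by (rule finite_subset[of _ "{0..m} \<times> {0..m} \<times> {0..m}"]) (auto simp: pos_triples_def)
  have "fps_nth (balancing_fps ^ 3) m =
      (\<Sum>(i, j)\<in>?S. balancing i * (balancing j * balancing (m - i - j)))"
    by (simp add: power3_eq_cube mult.assoc fps_mult_nth sum_distrib_left sum.Sigma)
  also have "\<dots> = (\<Sum>(j1, j2, j3)\<in>pos_triples (int m). balancing j1 * balancing j2 * balancing j3)"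
    \<comment> \<open>The convolution also runs over triples with a zero entry. These form the
      exceptional set \<open>S'\<close> and contribute nothing because
      \<open>balancing 0 = 0\<close>.\<close>
    by (rule sum.reindex_bij_witness_not_neutral
        [where S' = "{(i, j) \<in> ?S. i = 0 \<or> j = 0 \<or> i + j = m}" and T' = "{}"
          and j = "\<lambda>(i, j). (i, j, m - i - j)" and i = "\<lambda>(i, j, k). (i, j)"])
      (auto simp: pos_triples_def fin intro: finite_subset[of _ ?S])
  finally show ?thesis ..
qed

lemma sum_pos_triples_balancing_shift:
  "(\<Sum>(j1, j2, j3)\<in>pos_triples (int n - int k). balancing j1 * balancing j2 * balancing j3) =
     fps_nth (fps_X ^ k * balancing_fps ^ 3) n"
proof (cases "n < k")
  case True
  hence "pos_triples (int n - int k) = {}"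
    by (auto simp: pos_triples_def)
  with True show ?thesis
    by (simp add: fps_X_power_mult_nth)
next
  case False
  hence "fps_nth (fps_X ^ k * balancing_fps ^ 3) n = fps_nth (balancing_fps ^ 3) (n - k)"
    by (simp add: fps_X_power_mult_nth)
  with False show ?thesis
    using sum_pos_triples_balancing[of "n - k"] by simp
qed

text \<open>The cube identity only yields twice the claim, so binomials are needed in doubled form,
  free of division.\<close>

lemma two_mult_choose_two: "2 * int (m choose 2) = int m * (int m - 1)"
  by (induction m) (simp_all add: numeral_2_eq_2 algebra_simps)

theorem theorem2:
  fixes n :: nat
  assumes "n \<ge> 4"
  shows "(\<Sum>l=0..3. (-1) ^ l * int (3 choose l) *
            (\<Sum>(j1, j2, j3)\<in>pos_triples (int n - 2 * int l).
               balancing j1 * balancing j2 * balancing j3)) =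
         int ((n - 1) choose 2) * balancing (n - 2) - int ((n - 4) choose 2) * balancing (n - 4)"
    (is "?lhs = ?rhs")
proof -
  let ?F = balancing_fps
  have inner: "(\<Sum>(j1, j2, j3)\<in>pos_triples (int n - 2 * int l).
      balancing j1 * balancing j2 * balancing j3) = fps_nth (fps_X ^ (2 * l) * ?F ^ 3) n" for l
    using sum_pos_triples_balancing_shift[of n "2 * l"] by simp
  have expand: "(1 - fps_X ^ 2) ^ 3 * ?F ^ 3 =
      ?F ^ 3 - fps_const 3 * (fps_X ^ 2 * ?F ^ 3) + fps_const 3 * (fps_X ^ 4 * ?F ^ 3)
      - fps_X ^ 6 * ?F ^ 3"
    by (simp add: algebra_simps eval_nat_numeral flip: numeral_fps_const)
  have sum_0_3: "(\<Sum>l=0..3. f l) = f 0 + f 1 + f 2 + f 3" for f :: "nat \<Rightarrow> int"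
    by (simp add: eval_nat_numeral)
  have "?lhs = fps_nth ((1 - fps_X ^ 2) ^ 3 * ?F ^ 3) n"
    unfolding inner expand by (simp add: sum_0_3 choose_two)
  hence "2 * ?lhs = fps_nth (2 * ((1 - fps_X ^ 2) ^ 3 * ?F ^ 3)) n"
    by (simp add: numeral_fps_const)
  also have "\<dots> = 2 * fps_nth (fps_X ^ 3 * fps_deriv ?F) n
      + fps_nth (fps_X ^ 4 * fps_deriv (fps_deriv ?F)) n
      - fps_nth (fps_X ^ 6 * fps_deriv (fps_deriv ?F)) n"
    unfolding balancing_fps_cube by (simp add: numeral_fps_const left_diff_distrib)
  also have "fps_nth (fps_X ^ 3 * fps_deriv ?F) n = (int n - 2) * balancing (n - 2)"
  proof -
    have "n - 3 + 1 = n - 2" using assms by simp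
    with assms show ?thesis by (simp add: fps_X_power_mult_nth)
  qed
  also have "fps_nth (fps_X ^ 4 * fps_deriv (fps_deriv ?F)) n =
      (int n - 3) * (int n - 2) * balancing (n - 2)"
  proof -
    \<comment> \<open>The substitution removes truncated subtraction; \<open>balancing.simps\<close>
      is disabled below so that the recurrence does not unfold
      \<open>balancing (n - 2)\<close>.\<close>
    obtain k where "n = k + 4" using assms by (metis le_add_diff_inverse2)
    thus ?thesis
      by (simp add: fps_X_power_mult_nth add_ac del: balancing.simps)
  qed
  also have "fps_nth (fps_X ^ 6 * fps_deriv (fps_deriv ?F)) n =
      (int n - 5) * (int n - 4) * balancing (n - 4)"
  proof (cases "n < 6")
    case True
    \<comment> \<open>The coefficient is 0 here, and so is the right-hand side: one of the factors n
      - 5 and n - 4 vanishes.\<close>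
    with assms have "n = 4 \<or> n = 5" by auto
    thus ?thesis by (auto simp: fps_X_power_mult_nth)
  next
    case False
    then obtain k where "n = k + 6" by (metis le_add_diff_inverse2 not_less)
    thus ?thesis
      by (simp add: fps_X_power_mult_nth add_ac del: balancing.simps)
  qed
  \<comment> \<open>Uses 2(n-2) + (n-3)(n-2) = (n-1)(n-2).\<close>
  also have "2 * ((int n - 2) * balancing (n - 2)) + (int n - 3) * (int n - 2) * balancing (n - 2)
      - (int n - 5) * (int n - 4) * balancing (n - 4) =
      (2 * int ((n - 1) choose 2)) * balancing (n - 2)
      - (2 * int ((n - 4) choose 2)) * balancing (n - 4)"
    unfolding two_mult_choose_two using assms by (simp add: algebra_simps)
  also have "\<dots> = 2 * ?rhs" by simp
  finally show ?thesis by simp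
qed

end
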